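(* Let $\mathcal{X}=\overline{(X,0)}$ and $\mathcal{Y}=\overline{(Y,0)}$ be in $\overline{\mathbb{IR}}^{+}$ with $X=[x_1,x_2]$, $Y=[y_1,y_2]$, $x_1>0$, $y_1>0$. If $\dfrac{y_2}{y_1}\ge\dfrac{x_2}{x_1}$, then there exists a unique $\mathcal{Z}=\overline{(Z,0)}\in\overline{\mathbb{IR}}^{+}$ such that $\mathcal{Y}=\mathcal{X}\mathcal{Z}$.
   Context: $\mathbb{IR}$ is the set of intervals $[a,b]$ with real $a\le b$, with addition $[a,b]+[c,d]=[a+c,b+d]$; $0$ also denotes $[0,0]$. $\overline{\mathbb{IR}}$ is the quotient of $\mathbb{IR}\times\mathbb{IR}$ by $(x,y)\sim(z,t)\iff x+t=y+z$, the class of $(x,y)$ being $\overline{(x,y)}$. $\overline{\mathbb{IR}}^{+}$ is the subset of elements $\overline{(X,0)}$ with $X=[x_1,x_2]$ and $0\le x_1$. The product of intervals is $XY=[\min S,\max S]$ with $S=\{x_1y_1,x_1y_2,x_2y_1,x_2y_2\}$, and $\overline{(X,0)}\,\overline{(Y,0)}=\overline{(XY,0)}$. *)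

theory Defs
  imports Complex_Main "HOL-Library.Interval"
begin

definition gen_interval_rel ::
  "real interval \<times> real interval \<Rightarrow> real interval \<times> real interval \<Rightarrow> bool"
  where "gen_interval_rel = (\<lambda>(x, y) (z, t). x + t = y + z)"

lemma equivp_gen_interval_rel: "equivp gen_interval_rel"
  by (rule equivpI)
     (auto simp: gen_interval_rel_def reflp_def symp_def transp_def interval_eq_iff)

quotient_type gen_interval = "real interval \<times> real interval" / gen_interval_rel
  by (rule equivp_gen_interval_rel)

lift_definition gen_class :: "real interval \<Rightarrow> real interval \<Rightarrow> gen_interval"
  is "\<lambda>x y. (x, y)" .

lemma gen_class_eq_iff: "gen_class x y = gen_class z t \<longleftrightarrow> x + t = y + z"
  by transfer (simp add: gen_interval_rel_def)

lemma gen_class_zero_inject: "gen_class X 0 = gen_class Y 0 \<longleftrightarrow> X = Y"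
  by (auto simp: gen_class_eq_iff interval_eq_iff)

definition gen_interval_nonneg :: "gen_interval set"
  where "gen_interval_nonneg = {gen_class X 0 | X. 0 \<le> lower X}"

text \<open>The product is specified only on classes of the form \<open>gen_class X 0\<close>; by
  \<open>gen_class_zero_inject\<close> the representative \<open>X\<close> of such a class is unique, so the
  description below is well defined there. On all other arguments it is unspecified.\<close>

definition gen_times :: "gen_interval \<Rightarrow> gen_interval \<Rightarrow> gen_interval"  (infixl \<open>\<odot>\<close> 70)
  where "A \<odot> B =
    (THE C. \<exists>X Y. A = gen_class X 0 \<and> B = gen_class Y 0 \<and> C = gen_class (X * Y) 0)"

lemma gen_times_class: "gen_class X 0 \<odot> gen_class Y 0 = gen_class (X * Y) 0"
  by (auto simp: gen_times_def gen_class_zero_inject)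

end

theory Submission
  imports Defs
begin

text \<open>Intervals with nonnegative lower endpoints multiply endpoint by endpoint
  (\<open>times_interval_nonneg\<close>): by monotonicity the product of the lower endpoints is the
  least of the four products and that of the upper endpoints the greatest. As
  \<open>gen_class W 0\<close> determines \<open>W\<close>, the equation for the classes decouples
  into \<open>y1 = x1 * lower W\<close> and \<open>y2 = x2 * upper W\<close>, which has exactly one
  solution in real numbers. The ratio hypothesis makes these two numbers the endpoints of an
  interval.\<close>

lemma times_interval_nonneg:
  fixes X Z :: "'a::linordered_semiring interval"
  assumes "0 \<le> lower X" and "0 \<le> lower Z"
  shows "lower (X * Z) = lower X * lower Z" and "upper (X * Z) = upper X * upper Z"
proof -
  have X: "lower X \<le> upper X" and Z: "lower Z \<le> upper Z"
    by simp_all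
  have "0 \<le> upper X" "0 \<le> upper Z"
    using assms X Z by (auto intro: order_trans)
  then have "lower X * lower Z \<le> lower X * upper Z" "lower X * lower Z \<le> upper X * lower Z"
    "lower X * upper Z \<le> upper X * upper Z" "upper X * lower Z \<le> upper X * upper Z"
    using assms X Z by (auto intro!: mult_left_mono mult_right_mono)
  then show "lower (X * Z) = lower X * lower Z" "upper (X * Z) = upper X * upper Z"
    by (auto simp: lower_times upper_times min_def max_def)
qed

theorem proposition21:
  fixes X Y :: "real interval" and \<X> \<Y> :: gen_interval and x1 x2 y1 y2 :: real
  assumes "\<X> = gen_class X 0" and "\<Y> = gen_class Y 0"
    and "\<X> \<in> gen_interval_nonneg" and "\<Y> \<in> gen_interval_nonneg"
    and "lower X = x1" and "upper X = x2" and "lower Y = y1" and "upper Y = y2"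
    and "x1 > 0" and "y1 > 0"
    and "y2 / y1 \<ge> x2 / x1"
  shows "\<exists>!\<Z>. \<Z> \<in> gen_interval_nonneg \<and> \<Y> = \<X> \<odot> \<Z>"
proof -
  have "x1 \<le> x2"
    using assms lower_le_upper[of X] by simp
  then have x2: "x2 > 0"
    using assms by simp
  define Z where "Z = Interval (y1 / x1, y2 / x2)"
  \<comment> \<open>This is the ratio hypothesis with denominators cleared. It makes the pair a
    legitimate argument of \<open>Interval\<close>, so that \<open>Z\<close> really has these
    endpoints.\<close>
  have "y1 / x1 \<le> y2 / x2"
    using assms x2 by (simp add: field_simps)
  then have lZ: "lower Z = y1 / x1" and uZ: "upper Z = y2 / x2"
    by (simp_all add: Z_def lower.rep_eq upper.rep_eq Interval_inverse)
  have nonneg: "0 \<le> lower Z"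
    using assms lZ by simp
  \<comment> \<open>One equivalence yields both existence (\<open>W = Z\<close>) and uniqueness. The
    sign condition on \<open>W\<close> allows endpointwise multiplication; dividing by
    \<open>x1\<close> and \<open>x2\<close> then solves for \<open>W\<close>.\<close>
  have iff: "\<Y> = \<X> \<odot> gen_class W 0 \<longleftrightarrow> W = Z" if "0 \<le> lower W" for W
  proof -
    have "\<Y> = \<X> \<odot> gen_class W 0 \<longleftrightarrow> Y = X * W"
      by (simp add: assms(1,2) gen_times_class gen_class_zero_inject)
    also have "\<dots> \<longleftrightarrow> y1 = x1 * lower W \<and> y2 = x2 * upper W"
      using assms that by (simp add: interval_eq_iff times_interval_nonneg)
    also have "\<dots> \<longleftrightarrow> W = Z"
      using assms x2 by (auto simp: interval_eq_iff lZ uZ field_simps)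
    finally show ?thesis .
  qed
  show ?thesis
  proof (rule ex1I[of _ "gen_class Z 0"])
    show "gen_class Z 0 \<in> gen_interval_nonneg \<and> \<Y> = \<X> \<odot> gen_class Z 0"
      using nonneg iff[OF nonneg] by (auto simp: gen_interval_nonneg_def)
    \<comment> \<open>Membership supplies a representative \<open>W\<close> with
      \<open>0 \<le> lower W\<close>, to which \<open>iff\<close> applies.\<close>
    show "\<Z> = gen_class Z 0" if "\<Z> \<in> gen_interval_nonneg \<and> \<Y> = \<X> \<odot> \<Z>" for \<Z>
      using that iff by (auto simp: gen_interval_nonneg_def)
  qed
qed

end
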